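(* Let $R>0$, $\rho\in(-1,1)$, $\rho\ne 0$, $a=\frac{R}{\sqrt{1-|\rho|}}$, $b=\frac{R}{\sqrt{1+|\rho|}}$ and $q=\sqrt{\frac{a-b}{a+b}}\in(0,1)$. Then for all $q\le r<1$ and all $\theta,\tau\in\mathbb{R}$, $$\begin{aligned}&\frac{1}{2\pi}+\frac{1}{\pi}\sum_{k=1}^{\infty}r^k\left(\frac{1+\left(\frac{q}{r}\right)^{2k}}{1+q^{2k}}\cos k\theta\cos k\tau+\frac{1-\left(\frac{q}{r}\right)^{2k}}{1-q^{2k}}\sin k\theta\sin k\tau\right)\\ &=\frac{1}{2\pi}\,\frac{1-r^2}{1-2r\cos(\theta-\tau)+r^2}+\frac{1}{2\pi}\sum_{j=0}^{\infty}\Bigg[\frac{r^2-q^{4(2j+1)}}{r^2-2rq^{2(2j+1)}\cos(\theta+\tau)+q^{4(2j+1)}}\\ &\qquad-\frac{1-r^2q^{4(2j+1)}}{1-2rq^{2(2j+1)}\cos(\theta+\tau)+r^2q^{4(2j+1)}}-\frac{r^2-q^{8(j+1)}}{r^2-2rq^{4(j+1)}\cos(\theta-\tau)+q^{8(j+1)}}\\ &\qquad+\frac{1-r^2q^{8(j+1)}}{1-2rq^{4(j+1)}\cos(\theta-\tau)+r^2q^{8(j+1)}}\Bigg].\end{aligned}$$ *)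

theory Defs
  imports Complex_Main
begin

definition eigen_term :: "real \<Rightarrow> real \<Rightarrow> real \<Rightarrow> real \<Rightarrow> nat \<Rightarrow> real" where
  "eigen_term q r \<theta> \<tau> k =
     r ^ k * ((1 + (q / r) ^ (2 * k)) / (1 + q ^ (2 * k)) * cos (real k * \<theta>) * cos (real k * \<tau>)
            + (1 - (q / r) ^ (2 * k)) / (1 - q ^ (2 * k)) * sin (real k * \<theta>) * sin (real k * \<tau>))"

definition image_term :: "real \<Rightarrow> real \<Rightarrow> real \<Rightarrow> real \<Rightarrow> nat \<Rightarrow> real" where
  "image_term q r \<theta> \<tau> j =
     (r\<^sup>2 - q ^ (4 * (2 * j + 1)))
       / (r\<^sup>2 - 2 * r * q ^ (2 * (2 * j + 1)) * cos (\<theta> + \<tau>) + q ^ (4 * (2 * j + 1)))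
   - (1 - r\<^sup>2 * q ^ (4 * (2 * j + 1)))
       / (1 - 2 * r * q ^ (2 * (2 * j + 1)) * cos (\<theta> + \<tau>) + r\<^sup>2 * q ^ (4 * (2 * j + 1)))
   - (r\<^sup>2 - q ^ (8 * (j + 1)))
       / (r\<^sup>2 - 2 * r * q ^ (4 * (j + 1)) * cos (\<theta> - \<tau>) + q ^ (8 * (j + 1)))
   + (1 - r\<^sup>2 * q ^ (8 * (j + 1)))
       / (1 - 2 * r * q ^ (4 * (j + 1)) * cos (\<theta> - \<tau>) + r\<^sup>2 * q ^ (8 * (j + 1)))"

end

theory Submission
  imports Defs
begin

text \<open>
  With \<open>u = \<theta> - \<tau>\<close> and \<open>v = \<theta> + \<tau>\<close>, the product formulas turn the \<open>m\<close>-th term of the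
  eigenfunction series into a combination of \<open>cos (m * u)\<close> and \<open>cos (m * v)\<close> whose
  coefficients have the common denominator \<open>1 - q^(4m)\<close>. Splitting off \<open>r^m * cos (m * u)\<close>,
  which alone sums to the first Poisson kernel, leaves a quotient \<open>B / (1 - q^(4m))\<close>
  (lemma \<open>eigen_term_decomp\<close>).

  Expand \<open>1 / (1 - q^(4m))\<close> as a geometric series in powers \<open>q^(4mj)\<close> and exchange the sums
  over \<open>m\<close> and \<open>j\<close> (lemma \<open>sums_geometric_swap\<close>). For fixed \<open>j\<close>, the sum over \<open>m\<close> consists of four
  series of the form \<open>\<Sum>m. s^m * cos (m * \<phi>)\<close> with ratios \<open>r q^(4(j+1))\<close>, \<open>q^(4(j+1)) / r\<close>,
  \<open>q^(2(2j+1)) / r\<close>, \<open>r q^(2(2j+1))\<close>. Each of them is \<open>(P - 1) / 2\<close> for the Poisson kernel \<open>P\<close> at radius \<open>s\<close>;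
  two enter with each sign, so the constants cancel and half of the \<open>j\<close>-th image term
  remains. The assumption \<open>q \<le> r\<close> makes \<open>q\<^sup>2 / r \<le> q < 1\<close>, so all these ratios are below one.
\<close>

section \<open>The Poisson kernel of the unit disc\<close>

definition poisson :: "real \<Rightarrow> real \<Rightarrow> real" where
  "poisson s \<phi> = (1 - s\<^sup>2) / (1 - 2 * s * cos \<phi> + s\<^sup>2)"

lemma poisson_denominator_pos:
  fixes s \<phi> :: real
  assumes "\<bar>s\<bar> < 1"
  shows "0 < 1 - 2 * s * cos \<phi> + s\<^sup>2"
proof -
  have "\<bar>s * cos \<phi>\<bar> \<le> \<bar>s\<bar>"
    by (simp add: abs_mult mult_left_le)
  then have "s * cos \<phi> \<le> \<bar>s\<bar>"
    by linarith
  moreover have "0 < (1 - \<bar>s\<bar>)\<^sup>2"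
    using assms by simp
  ultimately show ?thesis
    by (simp add: power2_diff)
qed

text \<open>The series is the real part of the geometric series in \<open>s * cis \<phi>\<close>, without its first term.\<close>

lemma poisson_series:
  assumes "\<bar>s\<bar> < 1"
  shows "(\<lambda>k. s ^ Suc k * cos (real (Suc k) * \<phi>)) sums ((poisson s \<phi> - 1) / 2)"
proof -
  define z where "z = rcis s \<phi>"
  have "norm z < 1"
    using assms by (simp add: z_def)
  then have "(\<lambda>k. Re (z ^ k)) sums Re (1 / (1 - z))"
    by (intro sums_Re geometric_sums)
  moreover have "Re (z ^ k) = s ^ k * cos (real k * \<phi>)" for k
    by (simp add: z_def DeMoivre2)
  ultimately have "(\<lambda>k. s ^ k * cos (real k * \<phi>)) sums Re (1 / (1 - z))"
    by simp
  then have *: "(\<lambda>k. s ^ Suc k * cos (real (Suc k) * \<phi>)) sums (Re (1 / (1 - z)) - 1)"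
    by (subst sums_Suc_iff) simp
  have "(1 - s * cos \<phi>)\<^sup>2 + (s * sin \<phi>)\<^sup>2 = 1 - 2 * s * cos \<phi> + s\<^sup>2 * ((sin \<phi>)\<^sup>2 + (cos \<phi>)\<^sup>2)"
    by (simp only: power2_eq_square algebra_simps)
  then have "(1 - s * cos \<phi>)\<^sup>2 + (s * sin \<phi>)\<^sup>2 = 1 - 2 * s * cos \<phi> + s\<^sup>2"
    by (simp only: sin_cos_squared_add mult_1_right)
  then have "Re (1 / (1 - z)) = (1 - s * cos \<phi>) / (1 - 2 * s * cos \<phi> + s\<^sup>2)"
    by (simp add: z_def Re_divide)
  also have "\<dots> - 1 = (poisson s \<phi> - 1) / 2"
    using poisson_denominator_pos[OF assms, of \<phi>]
    by (simp add: poisson_def field_simps power2_eq_square)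
  finally show ?thesis
    using * by (simp only:)
qed

lemma poisson_series_abs_summable:
  fixes s \<phi> :: real
  assumes "\<bar>s\<bar> < 1"
  shows "summable (\<lambda>k. \<bar>s ^ Suc k * cos (real (Suc k) * \<phi>)\<bar>)"
proof (rule summable_comparison_test')
  show "summable (\<lambda>k. \<bar>s\<bar> ^ Suc k)"
    using assms by (subst summable_Suc_iff) (simp add: summable_geometric)
  show "norm \<bar>s ^ Suc k * cos (real (Suc k) * \<phi>)\<bar> \<le> \<bar>s\<bar> ^ Suc k" for k
    unfolding real_norm_def abs_abs abs_mult power_abs
    by (intro mult_left_le) auto
qed

lemma poisson_divide:
  assumes "r \<noteq> 0"
  shows "(r\<^sup>2 - w\<^sup>2) / (r\<^sup>2 - 2 * r * w * cos \<phi> + w\<^sup>2) = poisson (w / r) \<phi>"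
proof -
  have "r\<^sup>2 - w\<^sup>2 = r\<^sup>2 * (1 - (w / r)\<^sup>2)"
    and "r\<^sup>2 - 2 * r * w * cos \<phi> + w\<^sup>2 = r\<^sup>2 * (1 - 2 * (w / r) * cos \<phi> + (w / r)\<^sup>2)"
    using assms by (simp_all add: field_simps power2_eq_square)
  then show ?thesis
    using assms by (simp add: poisson_def)
qed

section \<open>Exchanging the two summations\<close>

text \<open>
  The uniform bound \<open>c\<close> on the ratios replaces a Fubini argument. Only finitely many series are
  added in a partial sum over \<open>j < n\<close>, so it equals \<open>\<Sum>k. B k / (1 - p k) * (1 - p k ^ n)\<close>; this
  differs from the limit by at most \<open>c ^ n\<close> times the absolute sum of the quotients.
\<close>

lemma sums_geometric_swap:
  fixes B p :: "nat \<Rightarrow> real"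
  assumes B: "summable (\<lambda>k. \<bar>B k\<bar>)" and p: "\<And>k. \<bar>p k\<bar> \<le> c" and c: "c < 1"
  shows "summable (\<lambda>k. B k / (1 - p k))"
    and "(\<lambda>j. \<Sum>k. B k * p k ^ j) sums (\<Sum>k. B k / (1 - p k))"
proof -
  define T where "T k = B k / (1 - p k)" for k
  have c0: "0 \<le> c"
    using p[of 0] by linarith
  have abs_T: "summable (\<lambda>k. \<bar>T k\<bar>)"
  proof (rule summable_comparison_test')
    show "summable (\<lambda>k. \<bar>B k\<bar> * (1 / (1 - c)))"
      using B by (rule summable_mult2)
    show "norm \<bar>T k\<bar> \<le> \<bar>B k\<bar> * (1 / (1 - c))" for k
    proof -
      have "1 - c \<le> \<bar>1 - p k\<bar>"
        using p[of k] by linarith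
      then show ?thesis
        using c by (simp add: T_def frac_le)
    qed
  qed
  then have sum_T: "summable T"
    by (rule summable_rabs_cancel)
  then show "summable (\<lambda>k. B k / (1 - p k))"
    by (simp add: T_def [abs_def])
  have pow: "\<bar>p k ^ j\<bar> \<le> c ^ j" for k j
    unfolding power_abs by (intro power_mono p) simp
  have inner: "summable (\<lambda>k. B k * p k ^ j)" for j
  proof (rule summable_comparison_test')
    show "summable (\<lambda>k. \<bar>B k\<bar> * c ^ j)"
      using B by (rule summable_mult2)
    show "norm (B k * p k ^ j) \<le> \<bar>B k\<bar> * c ^ j" for k
      using pow[of k j] by (simp add: abs_mult mult_left_mono)
  qed
  have rest_bound: "\<bar>T k * p k ^ n\<bar> \<le> \<bar>T k\<bar> * c ^ n" for k n
    using pow[of k n] by (simp add: abs_mult mult_left_mono)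
  have abs_rest: "summable (\<lambda>k. \<bar>T k * p k ^ n\<bar>)" for n
  proof (rule summable_comparison_test')
    show "summable (\<lambda>k. \<bar>T k\<bar> * c ^ n)"
      using abs_T by (rule summable_mult2)
    show "norm \<bar>T k * p k ^ n\<bar> \<le> \<bar>T k\<bar> * c ^ n" for k
      using rest_bound[of k n] by simp
  qed
  have partial: "(\<Sum>j<n. \<Sum>k. B k * p k ^ j) = suminf T - (\<Sum>k. T k * p k ^ n)" for n
  proof -
    have "(\<Sum>j<n. \<Sum>k. B k * p k ^ j) = (\<Sum>k. \<Sum>j<n. B k * p k ^ j)"
      by (rule suminf_sum [symmetric]) (rule inner)
    also have "(\<lambda>k. \<Sum>j<n. B k * p k ^ j) = (\<lambda>k. T k - T k * p k ^ n)"
    proof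
      fix k
      have "p k \<noteq> 1"
        using p[of k] c by auto
      then have "(\<Sum>j<n. p k ^ j) = (1 - p k ^ n) / (1 - p k)"
        by (simp add: sum_gp_strict)
      then have "(\<Sum>j<n. B k * p k ^ j) = B k * ((1 - p k ^ n) / (1 - p k))"
        by (simp add: sum_distrib_left [symmetric])
      then show "(\<Sum>j<n. B k * p k ^ j) = T k - T k * p k ^ n"
        by (simp add: T_def algebra_simps diff_divide_distrib)
    qed
    also have "(\<Sum>k. T k - T k * p k ^ n) = suminf T - (\<Sum>k. T k * p k ^ n)"
      by (intro suminf_diff [symmetric] sum_T summable_rabs_cancel [OF abs_rest])
    finally show ?thesis .
  qed
  have rest_le: "\<bar>\<Sum>k. T k * p k ^ n\<bar> \<le> suminf (\<lambda>k. \<bar>T k\<bar>) * c ^ n" for n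
  proof -
    have "\<bar>\<Sum>k. T k * p k ^ n\<bar> \<le> (\<Sum>k. \<bar>T k * p k ^ n\<bar>)"
      by (rule summable_rabs [OF abs_rest])
    also have "\<dots> \<le> (\<Sum>k. \<bar>T k\<bar> * c ^ n)"
      by (intro suminf_le rest_bound abs_rest summable_mult2 abs_T)
    also have "\<dots> = suminf (\<lambda>k. \<bar>T k\<bar>) * c ^ n"
      by (rule suminf_mult2 [OF abs_T, symmetric])
    finally show ?thesis .
  qed
  have "(\<lambda>n. suminf (\<lambda>k. \<bar>T k\<bar>) * c ^ n) \<longlonglongrightarrow> 0"
    using c0 c by (intro tendsto_mult_right_zero LIMSEQ_power_zero) simp
  then have "(\<lambda>n. \<Sum>k. T k * p k ^ n) \<longlonglongrightarrow> 0"
  proof (rule tendsto_0_le [where K = 1], intro always_eventually allI)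
    show "norm (\<Sum>k. T k * p k ^ n) \<le> norm (suminf (\<lambda>k. \<bar>T k\<bar>) * c ^ n) * 1" for n
      using rest_le[of n] unfolding real_norm_def by linarith
  qed
  then have "(\<lambda>n. suminf T - (\<Sum>k. T k * p k ^ n)) \<longlonglongrightarrow> suminf T - 0"
    by (intro tendsto_diff tendsto_const)
  then show "(\<lambda>j. \<Sum>k. B k * p k ^ j) sums (\<Sum>k. B k / (1 - p k))"
    by (simp add: sums_def partial T_def [abs_def])
qed

section \<open>From eigenfunctions to images\<close>

text \<open>
  The sum over \<open>m\<close> of the numerators, weighted by \<open>q^(4mj)\<close>, is half of the \<open>j\<close>-th image term.
  The first summand carries the extra factor \<open>q^4\<close> because its leading part
  \<open>r^m * cos (m * (\<theta> - \<tau>))\<close> has been split off, which aligns its powers with the image index.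
\<close>

definition image_numerator :: "real \<Rightarrow> real \<Rightarrow> real \<Rightarrow> real \<Rightarrow> nat \<Rightarrow> real" where
  "image_numerator q r \<theta> \<tau> m =
     (r * q ^ 4) ^ m * cos (real m * (\<theta> - \<tau>)) - (q ^ 4 / r) ^ m * cos (real m * (\<theta> - \<tau>))
   + (q\<^sup>2 / r) ^ m * cos (real m * (\<theta> + \<tau>)) - (r * q\<^sup>2) ^ m * cos (real m * (\<theta> + \<tau>))"

text \<open>
  With \<open>p = q^(2m)\<close> and \<open>y = (q\<^sup>2 / r)^m = r^m (q / r)^(2m)\<close>, the two fractions of the eigenfunction
  term have denominators \<open>1 + p\<close> and \<open>1 - p\<close>. Over the common denominator \<open>1 - p\<^sup>2\<close>, the coefficients
  of \<open>cos (m * (\<theta> - \<tau>))\<close> and \<open>cos (m * (\<theta> + \<tau>))\<close> become \<open>r^m - p y\<close> and \<open>y - p r^m\<close>.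
\<close>

lemma eigen_term_decomp:
  fixes q r \<theta> \<tau> :: real
  assumes q: "0 < q" "q < 1" and r: "0 < r" and m: "0 < m"
  shows "eigen_term q r \<theta> \<tau> m =
    r ^ m * cos (real m * (\<theta> - \<tau>)) + image_numerator q r \<theta> \<tau> m / (1 - (q ^ 4) ^ m)"
proof -
  define x y p where "x = r ^ m" and "y = (q\<^sup>2 / r) ^ m" and "p = (q\<^sup>2) ^ m"
  define \<alpha> \<beta> where "\<alpha> = real m * \<theta>" and "\<beta> = real m * \<tau>"
  have p: "0 < p" "p < 1"
    using q m by (auto simp: p_def power_less_one_iff)
  have "p * p < 1 * 1"
    using p by (intro mult_strict_mono) auto
  then have den: "1 + p \<noteq> 0" "1 - p \<noteq> 0" "1 - p * p \<noteq> 0"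
    using p by auto
  have q2m: "q ^ (2 * m) = p"
    by (simp add: p_def power_mult)
  have q4m: "(q ^ 4) ^ m = p * p"
    by (simp add: p_def power_mult [symmetric] power_add [symmetric])
  have xq: "x * (q / r) ^ (2 * m) = y"
  proof -
    have "r * (q / r)\<^sup>2 = q\<^sup>2 / r"
      using r by (simp add: power2_eq_square)
    then show ?thesis
      by (simp add: x_def y_def power_mult power_mult_distrib [symmetric])
  qed
  have "eigen_term q r \<theta> \<tau> m =
      (x + x * (q / r) ^ (2 * m)) / (1 + p) * (cos \<alpha> * cos \<beta>)
    + (x - x * (q / r) ^ (2 * m)) / (1 - p) * (sin \<alpha> * sin \<beta>)"
    unfolding eigen_term_def q2m x_def [symmetric] \<alpha>_def [symmetric] \<beta>_def [symmetric]
    by (simp add: algebra_simps add_divide_distrib diff_divide_distrib)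
  also have "\<dots> = (x + y) / (1 + p) * (cos \<alpha> * cos \<beta>) + (x - y) / (1 - p) * (sin \<alpha> * sin \<beta>)"
    by (simp only: xq)
  also have "\<dots> = x * (cos \<alpha> * cos \<beta> + sin \<alpha> * sin \<beta>)
      + ((x * (p * p) - y * p) * (cos \<alpha> * cos \<beta> + sin \<alpha> * sin \<beta>)
        + (y - x * p) * (cos \<alpha> * cos \<beta> - sin \<alpha> * sin \<beta>)) / (1 - p * p)"
  proof -
    have split: "X / (1 + p) * C + Y / (1 - p) * S = (X * (1 - p) * C + Y * (1 + p) * S) / (1 - p * p)"
      for X Y C S
    proof -
      have "1 - p * p = (1 + p) * (1 - p)"
        by (simp add: algebra_simps)
      then show ?thesis
        using den by (simp add: add_divide_distrib)
    qed
    have join: "X + N / (1 - p * p) = (X * (1 - p * p) + N) / (1 - p * p)" for X N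
      using den by (simp add: add_divide_distrib)
    show ?thesis
      unfolding split join by (rule arg_cong2 [where f = "(/)"]) (simp_all only: algebra_simps)
  qed
  also have "(x * (p * p) - y * p) * (cos \<alpha> * cos \<beta> + sin \<alpha> * sin \<beta>)
      + (y - x * p) * (cos \<alpha> * cos \<beta> - sin \<alpha> * sin \<beta>) = image_numerator q r \<theta> \<tau> m"
  proof -
    have "(r * q ^ 4) ^ m = x * (p * p)"
      by (simp add: power_mult_distrib q4m x_def)
    moreover have "(q ^ 4 / r) ^ m = y * p"
      by (simp add: power_divide y_def q4m) (simp add: p_def)
    moreover have "(r * q\<^sup>2) ^ m = x * p"
      by (simp add: power_mult_distrib x_def p_def)
    ultimately show ?thesis
      unfolding image_numerator_def right_diff_distrib distrib_left cos_diff cos_add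
        \<alpha>_def [symmetric] \<beta>_def [symmetric] y_def [symmetric]
      by (simp only: algebra_simps)
  qed
  finally show ?thesis
    by (simp add: q4m x_def \<alpha>_def \<beta>_def cos_diff right_diff_distrib)
qed

lemma image_ratio_bounds:
  fixes q r :: real
  assumes "0 < q" "q \<le> r" "r < 1"
  shows "\<bar>r * q ^ Suc n\<bar> < 1" and "\<bar>q ^ Suc (Suc n) / r\<bar> < 1"
proof -
  have q1: "q < 1"
    using assms by simp
  have Suc_n: "0 < q ^ Suc n" "q ^ Suc n < 1"
    using assms q1 by (simp_all add: power_Suc_less_one del: power_Suc)
  have "r * q ^ Suc n < 1 * 1"
    using assms Suc_n by (intro mult_strict_mono) auto
  then show "\<bar>r * q ^ Suc n\<bar> < 1"
    using assms Suc_n by (simp add: abs_mult)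
  have "q * q ^ Suc n < r * 1"
    using assms Suc_n by (intro mult_le_less_imp_less) auto
  then show "\<bar>q ^ Suc (Suc n) / r\<bar> < 1"
    using assms Suc_n by simp
qed

lemma image_numerator_abs_summable:
  assumes "0 < q" "q \<le> r" "r < 1"
  shows "summable (\<lambda>k. \<bar>image_numerator q r \<theta> \<tau> (Suc k)\<bar>)"
proof (rule summable_comparison_test')
  note bounds = image_ratio_bounds(1)[OF assms, of 3] image_ratio_bounds(2)[OF assms, of 2]
    image_ratio_bounds(2)[OF assms, of 0] image_ratio_bounds(1)[OF assms, of 1]
  have b: "\<bar>r * q ^ 4\<bar> < 1" "\<bar>q ^ 4 / r\<bar> < 1" "\<bar>q\<^sup>2 / r\<bar> < 1" "\<bar>r * q\<^sup>2\<bar> < 1"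
    using bounds by (simp_all add: eval_nat_numeral)
  let ?f = "\<lambda>s \<phi> k. \<bar>s ^ Suc k * cos (real (Suc k) * \<phi>)\<bar>"
  show "summable (\<lambda>k. ?f (r * q ^ 4) (\<theta> - \<tau>) k + ?f (q ^ 4 / r) (\<theta> - \<tau>) k
      + ?f (q\<^sup>2 / r) (\<theta> + \<tau>) k + ?f (r * q\<^sup>2) (\<theta> + \<tau>) k)"
    by (intro summable_add poisson_series_abs_summable b)
  show "norm \<bar>image_numerator q r \<theta> \<tau> (Suc k)\<bar> \<le> ?f (r * q ^ 4) (\<theta> - \<tau>) k
      + ?f (q ^ 4 / r) (\<theta> - \<tau>) k + ?f (q\<^sup>2 / r) (\<theta> + \<tau>) k + ?f (r * q\<^sup>2) (\<theta> + \<tau>) k" for k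
    unfolding image_numerator_def real_norm_def abs_abs by linarith
qed

lemma image_term_poisson:
  assumes "r \<noteq> 0"
  shows "image_term q r \<theta> \<tau> j =
     poisson (q ^ (2 * (2 * j + 1)) / r) (\<theta> + \<tau>) - poisson (r * q ^ (2 * (2 * j + 1))) (\<theta> + \<tau>)
   - poisson (q ^ (4 * (j + 1)) / r) (\<theta> - \<tau>) + poisson (r * q ^ (4 * (j + 1))) (\<theta> - \<tau>)"
proof -
  have sq: "q ^ (4 * (2 * j + 1)) = (q ^ (2 * (2 * j + 1)))\<^sup>2" "q ^ (8 * (j + 1)) = (q ^ (4 * (j + 1)))\<^sup>2"
    unfolding power_mult [symmetric] by (rule arg_cong [where f = "\<lambda>n. q ^ n"], simp)+
  show ?thesis
    unfolding image_term_def sq poisson_divide[OF assms]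
    by (simp only: poisson_def power_mult_distrib mult.assoc)
qed

lemma image_numerator_sums_image_term:
  assumes "0 < q" "q \<le> r" "r < 1"
  shows "(\<lambda>k. image_numerator q r \<theta> \<tau> (Suc k) * ((q ^ 4) ^ Suc k) ^ j) sums (image_term q r \<theta> \<tau> j / 2)"
proof -
  define w w' where "w = q ^ (2 * (2 * j + 1))" and "w' = q ^ (4 * (j + 1))"
  have "2 * (2 * j + 1) = Suc (Suc (4 * j))" "4 * (j + 1) = Suc (Suc (4 * j + 2))"
    by simp_all
  then have w: "w = q ^ Suc (Suc (4 * j))" and w': "w' = q ^ Suc (Suc (4 * j + 2))"
    unfolding w_def w'_def by (simp_all only:)
  have b: "\<bar>r * w'\<bar> < 1" "\<bar>w' / r\<bar> < 1" "\<bar>w / r\<bar> < 1" "\<bar>r * w\<bar> < 1"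
    unfolding w w' by (rule image_ratio_bounds[OF assms])+
  have "(\<lambda>k. (r * w') ^ Suc k * cos (real (Suc k) * (\<theta> - \<tau>)) - (w' / r) ^ Suc k * cos (real (Suc k) * (\<theta> - \<tau>))
      + (w / r) ^ Suc k * cos (real (Suc k) * (\<theta> + \<tau>)) - (r * w) ^ Suc k * cos (real (Suc k) * (\<theta> + \<tau>)))
    sums ((poisson (r * w') (\<theta> - \<tau>) - 1) / 2 - (poisson (w' / r) (\<theta> - \<tau>) - 1) / 2
      + (poisson (w / r) (\<theta> + \<tau>) - 1) / 2 - (poisson (r * w) (\<theta> + \<tau>) - 1) / 2)"
    by (intro sums_add sums_diff poisson_series b)
  moreover have "image_numerator q r \<theta> \<tau> m * ((q ^ 4) ^ m) ^ j =
      (r * w') ^ m * cos (real m * (\<theta> - \<tau>)) - (w' / r) ^ m * cos (real m * (\<theta> - \<tau>))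
    + (w / r) ^ m * cos (real m * (\<theta> + \<tau>)) - (r * w) ^ m * cos (real m * (\<theta> + \<tau>))" for m
  proof -
    define e where "e = ((q ^ 4) ^ j) ^ m"
    have e: "((q ^ 4) ^ m) ^ j = e"
      by (simp add: e_def power_mult [symmetric] ac_simps)
    have ww: "w' = q ^ 4 * (q ^ 4) ^ j" "w = q\<^sup>2 * (q ^ 4) ^ j"
      by (simp_all add: w_def w'_def power_mult [symmetric] power_add [symmetric])
    have "(r * w') ^ m = (r * q ^ 4) ^ m * e" "(w' / r) ^ m = (q ^ 4 / r) ^ m * e"
         "(w / r) ^ m = (q\<^sup>2 / r) ^ m * e" "(r * w) ^ m = (r * q\<^sup>2) ^ m * e"
      unfolding ww e_def power_mult_distrib [symmetric] by (simp_all add: mult.assoc)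
    then show ?thesis
      unfolding image_numerator_def e by (simp only: algebra_simps)
  qed
  moreover have "(poisson (r * w') (\<theta> - \<tau>) - 1) / 2 - (poisson (w' / r) (\<theta> - \<tau>) - 1) / 2
      + (poisson (w / r) (\<theta> + \<tau>) - 1) / 2 - (poisson (r * w) (\<theta> + \<tau>) - 1) / 2
    = image_term q r \<theta> \<tau> j / 2"
  proof -
    have "r \<noteq> 0"
      using assms by simp
    show ?thesis
      unfolding image_term_poisson[OF \<open>r \<noteq> 0\<close>] w_def [symmetric] w'_def [symmetric]
      by (simp add: diff_divide_distrib add_divide_distrib)
  qed
  ultimately show ?thesis
    by (simp only:)
qed

theorem mainTheorem3:
  fixes R \<rho> a b q :: real
  assumes "R > 0" and "-1 < \<rho>" and "\<rho> < 1" and "\<rho> \<noteq> 0"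
    and "a = R / sqrt (1 - \<bar>\<rho>\<bar>)"
    and "b = R / sqrt (1 + \<bar>\<rho>\<bar>)"
    and "q = sqrt ((a - b) / (a + b))"
  shows "0 < q \<and> q < 1 \<and>
    (\<forall>r \<theta> \<tau> :: real. q \<le> r \<and> r < 1 \<longrightarrow>
      summable (\<lambda>k. eigen_term q r \<theta> \<tau> (Suc k)) \<and>
      summable (image_term q r \<theta> \<tau>) \<and>
      1 / (2 * pi) + 1 / pi * (\<Sum>k. eigen_term q r \<theta> \<tau> (Suc k))
        = 1 / (2 * pi) * ((1 - r\<^sup>2) / (1 - 2 * r * cos (\<theta> - \<tau>) + r\<^sup>2))
          + 1 / (2 * pi) * (\<Sum>j. image_term q r \<theta> \<tau> j))"
proof -
  have "0 < b"
    using assms by simp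
  moreover have "b < a"
    unfolding assms(5,6) using assms(1-4) by (intro divide_strict_left_mono mult_pos_pos) auto
  ultimately have q: "0 < q" "q < 1"
    unfolding assms(7) by simp_all
  have "summable (\<lambda>k. eigen_term q r \<theta> \<tau> (Suc k)) \<and>
      summable (image_term q r \<theta> \<tau>) \<and>
      1 / (2 * pi) + 1 / pi * (\<Sum>k. eigen_term q r \<theta> \<tau> (Suc k))
        = 1 / (2 * pi) * ((1 - r\<^sup>2) / (1 - 2 * r * cos (\<theta> - \<tau>) + r\<^sup>2))
          + 1 / (2 * pi) * (\<Sum>j. image_term q r \<theta> \<tau> j)"
    if qr: "q \<le> r" and r1: "r < 1" for r \<theta> \<tau> :: real
  proof -
    define B p where "B = (\<lambda>k. image_numerator q r \<theta> \<tau> (Suc k))" and "p = (\<lambda>k. (q ^ 4) ^ Suc k)"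
    define S where "S = (\<Sum>k. B k / (1 - p k))"
    have r0: "0 < r"
      using q qr by linarith
    have q4: "q ^ 4 < 1"
      using q by (simp add: power_less_one_iff)
    have p_bound: "\<bar>p k\<bar> \<le> q ^ 4" for k
    proof -
      have "q ^ 4 * (q ^ 4) ^ k \<le> q ^ 4 * 1"
        using q by (intro mult_left_mono power_le_one) auto
      then show ?thesis
        by (simp add: p_def)
    qed
    have "summable (\<lambda>k. \<bar>B k\<bar>)"
      unfolding B_def by (rule image_numerator_abs_summable[OF q(1) qr r1])
    note swap = sums_geometric_swap[where p = p and c = "q ^ 4", OF this p_bound q4]
    have "(\<Sum>k. B k * p k ^ j) = image_term q r \<theta> \<tau> j / 2" for j
      unfolding B_def p_def
      by (rule sums_unique[OF image_numerator_sums_image_term[OF q(1) qr r1], symmetric])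
    then have "(\<lambda>j. image_term q r \<theta> \<tau> j / 2) sums S"
      using swap(2) by (simp only: S_def)
    from sums_mult[OF this, of 2] have img: "image_term q r \<theta> \<tau> sums (2 * S)"
      by simp
    have "(\<lambda>k. r ^ Suc k * cos (real (Suc k) * (\<theta> - \<tau>)) + B k / (1 - p k))
        sums ((poisson r (\<theta> - \<tau>) - 1) / 2 + S)"
      unfolding S_def using r0 r1 by (intro sums_add poisson_series summable_sums swap(1)) simp
    moreover have "eigen_term q r \<theta> \<tau> (Suc k) =
        r ^ Suc k * cos (real (Suc k) * (\<theta> - \<tau>)) + B k / (1 - p k)" for k
      unfolding B_def p_def by (rule eigen_term_decomp[OF q r0]) simp
    ultimately have eig: "(\<lambda>k. eigen_term q r \<theta> \<tau> (Suc k)) sums ((poisson r (\<theta> - \<tau>) - 1) / 2 + S)"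
      by (simp only:)
    have "1 / (2 * pi) + 1 / pi * ((poisson r (\<theta> - \<tau>) - 1) / 2 + S)
        = 1 / (2 * pi) * poisson r (\<theta> - \<tau>) + 1 / (2 * pi) * (2 * S)"
      by (simp add: field_simps)
    then show ?thesis
      using sums_summable[OF eig] sums_summable[OF img]
      unfolding sums_unique[OF eig, symmetric] sums_unique[OF img, symmetric] poisson_def
      by blast
  qed
  with q show ?thesis
    by blast
qed

end
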